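(* Consider the finite-horizon perfect observation problem described in the context (choose encoding, memory update and control strategies to minimize the expected total cost), for any arbitrary (but fixed) encoding and memory update strategies $c=(c_1,\dots,c_T)$ and $l=(l_1,\dots,l_T)$. Then, without loss of optimality, we can restrict attention to control laws of the form $$U_t=g_t\big(P_{X_t,M_t}\big),$$ where $P_{X_t,M_t}$ is the controller's belief on $(X_t,M_t)$ defined in the context.
   Context: Perfect observation system. $\mathcal X,\mathcal W,\mathcal M,\mathcal Z,\mathcal N,\mathcal Y,\mathcal U$ are finite sets and $T$ is a finite horizon. For a sequence, $x^t$ denotes $(x_1,\dots,x_t)$. For $t=1,\dots,T$: - Plant: $X_{t+1}=f(X_t,U_t,W_t)$, with state $X_t\in\mathcal X$, control action $U_t\in\mathcal U$, disturbance $W_t\in\mathcal W$. $X_1$ has PMF $P_{X_1}$; $W_1,\dots,W_T$ are i.i.d. with PMF $P_W$ and independent of $X_1$. - Encoder: $Z_t=c_t(X_t,M_{t-1})\in\mathcal Z$, with $c_t:\mathcal X\times\mathcal M\to\mathcal Z$, where $M_{t-1}$ is the content of the sensor's memory at $t-1$. - Sensor memory: $M_t=l_t(X_t,M_{t-1})\in\mathcal M$, with $l_t:\mathcal X\times\mathcal M\to\mathcal M$. - Channel: $Y_t=h(Z_t,N_t)\in\mathcal Y$; the noises $N_1,\dots,N_T\in\mathcal N$ are i.i.d. with PMF $P_N$ and independent of $X_1,W_1,\dots,W_T$. - Controller: $U_t=g_t(Y^t,U^{t-1})$; a general control law at time $t$ is a function $g_t:\mathcal Y^t\times\mathcal U^{t-1}\to\mathcal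 U$. The functions $f,h$ are given, as is a cost function $\rho:\mathcal X\times\mathcal U\to[0,K]$, $K<\infty$. The performance of a design $(c,l,g)$, $g=(g_1,\dots,g_T)$, is $\mathcal J_T(c,l,g)=\mathbb E\big\{\sum_{t=1}^T\rho(X_t,U_t)\,\big|\,c,l,g\big\}$, which is to be minimized. The controller's belief $P_{X_t,M_t}$ is the random vector $$P_{X_t,M_t}(x,m)=\Pr\big(X_t=x,M_t=m\mid Y^t,U^{t-1},c^t,l^t,g^{t-1}\big),$$ where conditioning on decision rules means that these (arbitrary but fixed) rules are used. It takes values in $\mathcal P^{\mathcal X\times\mathcal M}$, the space of PMFs on $\mathcal X\times\mathcal M$; in the restricted form of control law, $g_t$ is a function from $\mathcal P^{\mathcal X\times\mathcal M}$ to $\mathcal U$. *)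

theory Defs
  imports "HOL-Probability.Probability"
begin

text \<open>
  The finite sets of the model are finite types. Time runs over \<open>1, \<dots>, T\<close>, where
  \<open>T\<close> is the horizon. The initial memory content \<open>M\<^sub>0\<close>, the second argument of the
  first encoding and memory update rules, is a fixed but arbitrary element.
\<close>

record ('x, 'w, 'm, 'z, 'n, 'y, 'u) ncs =
  horizon :: nat
  init_pmf :: "'x pmf"
  disturbance_pmf :: "'w pmf"
  noise_pmf :: "'n pmf"
  plant :: "'x \<Rightarrow> 'u \<Rightarrow> 'w \<Rightarrow> 'x"
  channel :: "'z \<Rightarrow> 'n \<Rightarrow> 'y"
  init_mem :: 'm
  cost :: "'x \<Rightarrow> 'u \<Rightarrow> real"

type_synonym ('x, 'm, 'z) encoder = "nat \<Rightarrow> 'x \<Rightarrow> 'm \<Rightarrow> 'z"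
type_synonym ('x, 'm) memory_update = "nat \<Rightarrow> 'x \<Rightarrow> 'm \<Rightarrow> 'm"

text \<open>
  The rule \<open>g t ys us\<close> is only ever applied to lists \<open>ys = [Y\<^sub>1, \<dots>, Y\<^sub>t]\<close> and
  \<open>us = [U\<^sub>1, \<dots>, U\<^bsub>t-1\<^esub>]\<close>; its values on lists of other lengths are irrelevant.
\<close>
type_synonym ('y, 'u) control_law = "nat \<Rightarrow> 'y list \<Rightarrow> 'u list \<Rightarrow> 'u"

type_synonym ('x, 'm, 'u) belief_law = "nat \<Rightarrow> ('x \<times> 'm) pmf \<Rightarrow> 'u"

text \<open>
  An outcome \<open>(x\<^sub>1, w, n)\<close> lists the realizations of \<open>X\<^sub>1\<close>, of \<open>W\<^sub>1, \<dots>, W\<^sub>T\<close> and of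
  \<open>N\<^sub>1, \<dots>, N\<^sub>T\<close>. Outside \<open>{1..T}\<close> the functions \<open>w\<close> and \<open>n\<close> are almost surely
  \<^const>\<open>undefined\<close>.
\<close>
type_synonym ('x, 'w, 'n) outcome = "'x \<times> (nat \<Rightarrow> 'w) \<times> (nat \<Rightarrow> 'n)"

definition primitives ::
  "('x, 'w, 'm, 'z, 'n, 'y, 'u) ncs \<Rightarrow> ('x, 'w, 'n) outcome pmf" where
  "primitives S =
     pair_pmf (init_pmf S)
       (pair_pmf (Pi_pmf {1..horizon S} undefined (\<lambda>_. disturbance_pmf S))
                 (Pi_pmf {1..horizon S} undefined (\<lambda>_. noise_pmf S)))"

text \<open>
  \<open>traj S c l g \<omega> t = (X\<^bsub>t+1\<^esub>, M\<^sub>t, [Y\<^sub>1, \<dots>, Y\<^sub>t], [U\<^sub>1, \<dots>, U\<^sub>t])\<close>.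
\<close>
primrec traj ::
  "('x, 'w, 'm, 'z, 'n, 'y, 'u) ncs \<Rightarrow> ('x, 'm, 'z) encoder \<Rightarrow> ('x, 'm) memory_update \<Rightarrow>
   ('y, 'u) control_law \<Rightarrow> ('x, 'w, 'n) outcome \<Rightarrow> nat \<Rightarrow> 'x \<times> 'm \<times> 'y list \<times> 'u list" where
  "traj S c l g \<omega> 0 = (fst \<omega>, init_mem S, [], [])"
| "traj S c l g \<omega> (Suc t) =
     (case (\<omega>, traj S c l g \<omega> t) of ((_, w, n), (x, m, ys, us)) \<Rightarrow>
       let z = c (Suc t) x m;
           ys' = ys @ [channel S z (n (Suc t))];
           u = g (Suc t) ys' us
       in (plant S x u (w (Suc t)), l (Suc t) x m, ys', us @ [u]))"

context
  fixes S :: "('x, 'w, 'm, 'z, 'n, 'y, 'u) ncs"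
    and c :: "('x, 'm, 'z) encoder"
    and l :: "('x, 'm) memory_update"
    and g :: "('y, 'u) control_law"
begin

definition state :: "nat \<Rightarrow> ('x, 'w, 'n) outcome \<Rightarrow> 'x" where
  "state t \<omega> = fst (traj S c l g \<omega> (t - 1))"

definition memory :: "nat \<Rightarrow> ('x, 'w, 'n) outcome \<Rightarrow> 'm" where
  "memory t \<omega> = fst (snd (traj S c l g \<omega> t))"

definition obs_hist :: "nat \<Rightarrow> ('x, 'w, 'n) outcome \<Rightarrow> 'y list" where
  "obs_hist t \<omega> = fst (snd (snd (traj S c l g \<omega> t)))"

definition act_hist :: "nat \<Rightarrow> ('x, 'w, 'n) outcome \<Rightarrow> 'u list" where
  "act_hist t \<omega> = snd (snd (snd (traj S c l g \<omega> t)))"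

definition control :: "nat \<Rightarrow> ('x, 'w, 'n) outcome \<Rightarrow> 'u" where
  "control t \<omega> = g t (obs_hist t \<omega>) (act_hist (t - 1) \<omega>)"

lemma closed_loop_init:
  "state 1 \<omega> = fst \<omega>" "memory 0 \<omega> = init_mem S" "obs_hist 0 \<omega> = []" "act_hist 0 \<omega> = []"
  by (simp_all add: state_def memory_def obs_hist_def act_hist_def)

lemma closed_loop_step:
  assumes "t \<ge> 1"
  shows "state (t + 1) \<omega> = plant S (state t \<omega>) (control t \<omega>) (fst (snd \<omega>) t)"
    and "memory t \<omega> = l t (state t \<omega>) (memory (t - 1) \<omega>)"
    and "obs_hist t \<omega> = obs_hist (t - 1) \<omega> @
           [channel S (c t (state t \<omega>) (memory (t - 1) \<omega>)) (snd (snd \<omega>) t)]"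
    and "act_hist t \<omega> = act_hist (t - 1) \<omega> @ [control t \<omega>]"
  using assms
  by (cases t; simp add: state_def memory_def obs_hist_def act_hist_def control_def
      Let_def split: prod.splits)+

definition performance :: real where
  "performance = measure_pmf.expectation (primitives S)
     (\<lambda>\<omega>. \<Sum>t=1..horizon S. cost S (state t \<omega>) (control t \<omega>))"

text \<open>
  The random vector \<open>P\<^bsub>X\<^sub>t,M\<^sub>t\<^esub>\<close>. For every outcome of positive probability the conditioning
  event has positive probability, so \<^const>\<open>cond_pmf\<close> is the conditional distribution there.
  Rules used after the times \<open>t\<close> (for \<open>c\<close> and \<open>l\<close>) and \<open>t - 1\<close> (for \<open>g\<close>) do not enter.
\<close>
definition belief :: "nat \<Rightarrow> ('x, 'w, 'n) outcome \<Rightarrow> ('x \<times> 'm) pmf" where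
  "belief t \<omega> = map_pmf (\<lambda>\<omega>'. (state t \<omega>', memory t \<omega>'))
     (cond_pmf (primitives S)
       {\<omega>'. obs_hist t \<omega>' = obs_hist t \<omega> \<and> act_hist (t - 1) \<omega>' = act_hist (t - 1) \<omega>})"

text \<open>
  The general control law \<open>g\<close> has the restricted form \<open>U\<^sub>t = \<gamma>\<^sub>t(P\<^bsub>X\<^sub>t,M\<^sub>t\<^esub>)\<close>. On histories
  of probability zero there is no belief, hence the equation is required almost surely.
\<close>
definition belief_form :: "('x, 'm, 'u) belief_law \<Rightarrow> bool" where
  "belief_form \<gamma> \<longleftrightarrow>
     (\<forall>t\<in>{1..horizon S}. AE \<omega> in measure_pmf (primitives S). control t \<omega> = \<gamma> t (belief t \<omega>))"

end

end

theory Submission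
  imports Defs
begin

text \<open>
  By Bayes' rule the conditional law of \<open>(X\<^sub>t, M\<^sub>t)\<close> given \<open>(Y\<^sup>t, U\<^bsup>t-1\<^esup>)\<close> satisfies a recursion
  (prediction with the plant, correction with the channel) in which the control law does not
  occur: the actions enter only through their realized values. So the law of the histories together
  with \<open>(X\<^sub>t, M\<^sub>t)\<close> disintegrates over the histories with one kernel for all control laws, the
  expected cost of a control law only depends on the induced process of beliefs, and this process is
  controlled Markov. Backward dynamic programming on beliefs bounds every performance from below,
  and a law that minimizes the action value of the current belief attains the bound.
\<close>

section \<open>Disintegration of discrete joint laws\<close>

definition attach :: "'h pmf \<Rightarrow> ('h \<Rightarrow> 's pmf) \<Rightarrow> ('s \<times> 'h) pmf" where
  "attach H \<kappa> = bind_pmf H (\<lambda>h. map_pmf (\<lambda>s. (s, h)) (\<kappa> h))"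

text \<open>Conditional law of the first component given the second; it is meaningful only when
  \<open>h\<close> has positive probability.\<close>

definition fibre :: "('s \<times> 'h) pmf \<Rightarrow> 'h \<Rightarrow> 's pmf" where
  "fibre P h = map_pmf fst (cond_pmf P (snd -` {h}))"

lemma map_snd_attach: "map_pmf snd (attach H \<kappa>) = H"
  by (simp add: attach_def map_bind_pmf map_pmf_comp bind_return_pmf')

lemma pmf_map_Pair: "pmf (map_pmf (\<lambda>s. (s, h)) p) (s, h') = (if h' = h then pmf p s else 0)"
proof (cases "h' = h")
  case True
  have "inj (\<lambda>s. (s, h))" by (simp add: inj_def)
  from pmf_map_inj'[OF this] show ?thesis using True by simp
next
  case False
  then show ?thesis by (auto intro!: pmf_map_outside)
qed

lemma pmf_attach: "pmf (attach H \<kappa>) (s, h) = pmf H h * pmf (\<kappa> h) s"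
proof -
  have "pmf (attach H \<kappa>) (s, h) = measure_pmf.expectation H (\<lambda>h'. if h' = h then pmf (\<kappa> h) s else 0)"
    unfolding attach_def pmf_bind pmf_map_Pair
    by (intro arg_cong[where f = "measure_pmf.expectation H"]) auto
  also have "\<dots> = pmf H h * pmf (\<kappa> h) s"
    by (subst integral_measure_pmf_real[of "{h}"]) (auto split: if_splits)
  finally show ?thesis .
qed

text \<open>Uniqueness of the disintegration: the mass over \<open>h\<close> is
  \<open>pmf H h\<close> times \<open>\<kappa> h\<close>, and conditioning divides by
  \<open>pmf H h\<close>.\<close>

lemma fibre_attach:
  assumes "h \<in> set_pmf H"
  shows "fibre (attach H \<kappa>) h = \<kappa> h"
proof -
  have ne: "set_pmf (attach H \<kappa>) \<inter> snd -` {h} \<noteq> {}"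
  proof -
    have "h \<in> snd ` set_pmf (attach H \<kappa>)"
      using assms by (simp flip: set_map_pmf add: map_snd_attach)
    then show ?thesis by auto
  qed
  have "measure_pmf.prob (attach H \<kappa>) (snd -` {h}) = pmf H h"
    by (subst pmf_map[symmetric]) (simp add: map_snd_attach)
  moreover have "pmf H h \<noteq> 0"
    using assms by (simp add: set_pmf_iff)
  ultimately have "cond_pmf (attach H \<kappa>) (snd -` {h}) = map_pmf (\<lambda>s. (s, h)) (\<kappa> h)"
    by (intro pmf_eqI) (auto simp: pmf_cond[OF ne] pmf_attach pmf_map_Pair)
  then show ?thesis
    by (simp add: fibre_def map_pmf_comp)
qed

text \<open>Existence of the disintegration, by the law of total probability.\<close>

lemma attach_fibre:
  fixes P :: "('s \<times> 'h) pmf"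
  shows "attach (map_pmf snd P) (fibre P) = P"
proof -
  have "attach (map_pmf snd P) (fibre P) = bind_pmf (map_pmf snd P) (\<lambda>h. cond_pmf P (snd -` {h}))"
    unfolding attach_def
  proof (rule bind_pmf_cong[OF refl])
    fix h assume "h \<in> set_pmf (map_pmf snd P)"
    then have ne: "set_pmf P \<inter> snd -` {h} \<noteq> {}" by auto
    show "map_pmf (\<lambda>s. (s, h)) (fibre P h) = cond_pmf P (snd -` {h})"
      unfolding fibre_def map_pmf_comp
      by (intro map_pmf_idI) (auto simp: set_cond_pmf[OF ne])
  qed
  also have "\<dots> = bind_pmf (map_pmf snd P) (\<lambda>h. cond_pmf P {z. snd z = h})"
    by (simp add: vimage_def)
  also have "\<dots> = P"
  proof (rule bind_cond_pmf_cancel)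
    fix h and z :: "'s \<times> 'h" assume "snd z = h"
    then show "measure_pmf.prob P {z. snd z = h} = measure_pmf.prob (map_pmf snd P) {x. snd z = x}"
      by (simp add: vimage_def)
  qed auto
  finally show ?thesis .
qed

lemma expectation_bind_pmf:
  fixes h :: "'b \<Rightarrow> real"
  assumes "finite (set_pmf p)" "\<And>x. x \<in> set_pmf p \<Longrightarrow> finite (set_pmf (f x))"
  shows "measure_pmf.expectation (bind_pmf p f) h =
    measure_pmf.expectation p (\<lambda>x. measure_pmf.expectation (f x) h)"
  using assms by (simp add: pmf_expectation_bind[of "set_pmf p"] integral_measure_pmf[of "set_pmf p"])

lemma expectation_mono_pmf:
  fixes f g :: "'a \<Rightarrow> real"
  assumes "finite (set_pmf p)" "\<And>x. x \<in> set_pmf p \<Longrightarrow> f x \<le> g x"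
  shows "measure_pmf.expectation p f \<le> measure_pmf.expectation p g"
  using assms by (intro integral_mono_AE integrable_measure_pmf_finite) (auto simp: AE_measure_pmf_iff)

section \<open>Independence of the current noises from the past\<close>

lemma Pi_pmf_extract:
  assumes "finite A" "a \<in> A"
  shows "Pi_pmf A d p = map_pmf (\<lambda>(y, f). f(a := y)) (pair_pmf (p a) (Pi_pmf (A - {a}) d p))"
  using assms by (subst Pi_pmf_insert[symmetric]) (auto simp: insert_absorb)

lemma traj_cong:
  assumes "\<And>s. s \<in> {1..t} \<Longrightarrow> w s = w' s \<and> n s = n' s"
  shows "traj S c l g (x, w, n) t = traj S c l g (x, w', n') t"
  using assms by (induction t) (auto simp: Let_def split: prod.splits)

lemma pair_pmf_shuffle:
  "pair_pmf p (pair_pmf (pair_pmf q q') (pair_pmf r r')) =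
    map_pmf (\<lambda>((x, y', z'), y, z). (x, (y, y'), (z, z'))) (pair_pmf (pair_pmf p (pair_pmf q' r')) (pair_pmf q r))"
  (is "_ = map_pmf ?f ?P")
proof (rule pmf_eqI, clarsimp)
  fix x y y' z z'
  have "inj ?f" by (auto simp: inj_def)
  then have "pmf (map_pmf ?f ?P) (?f ((x, y', z'), y, z)) = pmf ?P ((x, y', z'), y, z)"
    by (rule pmf_map_inj')
  then show "pmf (pair_pmf p (pair_pmf (pair_pmf q q') (pair_pmf r r'))) (x, (y, y'), z, z') =
      pmf (map_pmf ?f ?P) (x, (y, y'), z, z')"
    by (simp add: pmf_pair)
qed

text \<open>By causality the trajectory up to \<open>t\<close> ignores coordinate
  \<open>Suc t\<close> of both noise sequences, and these coordinates split off as independent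
  factors of the product law.\<close>

lemma traj_noise_indep:
  assumes "t < horizon S"
  shows "map_pmf (\<lambda>\<omega>. (traj S c l g \<omega> t, fst (snd \<omega>) (Suc t), snd (snd \<omega>) (Suc t))) (primitives S) =
    pair_pmf (map_pmf (\<lambda>\<omega>. traj S c l g \<omega> t) (primitives S))
      (pair_pmf (disturbance_pmf S) (noise_pmf S))" (is "map_pmf ?F _ = pair_pmf ?R ?N")
proof -
  let ?I = "{1..horizon S} - {Suc t}"
  \<comment> \<open>Law of the trajectory with the noises at \<open>Suc t\<close> left at the
    default \<open>undefined\<close>; by \<open>upd\<close> this value does not matter.\<close>
  define R where "R = map_pmf (\<lambda>\<omega>. traj S c l g \<omega> t)
    (pair_pmf (init_pmf S) (pair_pmf (Pi_pmf ?I undefined (\<lambda>_. disturbance_pmf S))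
      (Pi_pmf ?I undefined (\<lambda>_. noise_pmf S))))"
  have upd: "traj S c l g (x, w(Suc t := a), n(Suc t := b)) t = traj S c l g (x, w, n) t" for x w n a b
    by (rule traj_cong) auto
  have ext: "Pi_pmf {1..horizon S} undefined (\<lambda>_. p) =
      map_pmf (\<lambda>(y, f). f(Suc t := y)) (pair_pmf p (Pi_pmf ?I undefined (\<lambda>_. p)))"
    for p :: "'k pmf"
    using assms by (intro Pi_pmf_extract) auto
  have *: "map_pmf ?F (primitives S) = pair_pmf R ?N"
    unfolding primitives_def ext R_def pair_map_pmf1 pair_map_pmf2 pair_pmf_shuffle
    by (auto simp: map_pmf_comp upd intro!: map_pmf_cong)
  have "R = map_pmf fst (map_pmf ?F (primitives S))"
    unfolding * map_fst_pair_pmf ..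
  also have "\<dots> = ?R" by (simp add: map_pmf_comp)
  finally show ?thesis using * by simp
qed


section \<open>Belief recursion and laws of the histories\<close>

context
  fixes S :: "('x::finite, 'w::finite, 'm::finite, 'z::finite, 'n::finite, 'y::finite, 'u::finite) ncs"
    and c :: "('x, 'm, 'z) encoder"
    and l :: "('x, 'm) memory_update"
begin

text \<open>Turns a law of (X_t, M_(t-1)) into the joint law of (X_t, M_t) and Y_t; encoder and
  memory update both read the old memory.\<close>

definition observe :: "nat \<Rightarrow> ('x \<times> 'm) pmf \<Rightarrow> (('x \<times> 'm) \<times> 'y) pmf" where
  "observe t p = bind_pmf p
     (\<lambda>(x, m). map_pmf (\<lambda>n. ((x, l t x m), channel S (c t x m) n)) (noise_pmf S))"

definition predict :: "('x \<times> 'm) pmf \<Rightarrow> 'u \<Rightarrow> ('x \<times> 'm) pmf" where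
  "predict b u = bind_pmf b (\<lambda>(x, m). map_pmf (\<lambda>w. (plant S x u w, m)) (disturbance_pmf S))"

text \<open>
  \<open>prior t\<close> is the belief on \<open>(X\<^bsub>t+1\<^esub>, M\<^sub>t)\<close> given \<open>(Y\<^sup>t, U\<^sup>t)\<close>, and \<open>posterior t\<close> is the belief on
  \<open>(X\<^bsub>t+1\<^esub>, M\<^bsub>t+1\<^esub>)\<close> given \<open>(Y\<^bsup>t+1\<^esup>, U\<^sup>t)\<close>.
\<close>
primrec prior :: "nat \<Rightarrow> 'y list \<Rightarrow> 'u list \<Rightarrow> ('x \<times> 'm) pmf" where
  "prior 0 ys us = map_pmf (\<lambda>x. (x, init_mem S)) (init_pmf S)"
| "prior (Suc t) ys us =
     predict (fibre (observe (Suc t) (prior t (butlast ys) (butlast us))) (last ys)) (last us)"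

definition posterior :: "nat \<Rightarrow> 'y list \<Rightarrow> 'u list \<Rightarrow> ('x \<times> 'm) pmf" where
  "posterior t ys us = fibre (observe (Suc t) (prior t (butlast ys) us)) (last ys)"

lemma prior_Suc_append: "prior (Suc t) ys (us @ [u]) = predict (posterior t ys us) u"
  by (simp add: posterior_def)

text \<open>Law of (Y^t, U^t) generated by the filter alone, each observation being drawn from its
  predictive law; \<open>law_pre_obs\<close> ties it to the closed loop.\<close>

primrec hist_law :: "('y, 'u) control_law \<Rightarrow> nat \<Rightarrow> ('y list \<times> 'u list) pmf" where
  "hist_law g 0 = return_pmf ([], [])"
| "hist_law g (Suc t) = bind_pmf (hist_law g t) (\<lambda>(ys, us).
     map_pmf (\<lambda>y. (ys @ [y], us @ [g (Suc t) (ys @ [y]) us]))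
       (map_pmf snd (observe (Suc t) (prior t ys us))))"

text \<open>Carries t+1 observations but t actions: what is known when action t+1 is chosen.\<close>

definition obs_law :: "('y, 'u) control_law \<Rightarrow> nat \<Rightarrow> ('y list \<times> 'u list) pmf" where
  "obs_law g t = bind_pmf (hist_law g t) (\<lambda>(ys, us).
     map_pmf (\<lambda>y. (ys @ [y], us)) (map_pmf snd (observe (Suc t) (prior t ys us))))"

lemma hist_law_Suc:
  "hist_law g (Suc t) = map_pmf (\<lambda>(ys, us). (ys, us @ [g (Suc t) ys us])) (obs_law g t)"
  by (simp add: obs_law_def map_bind_pmf map_pmf_comp case_prod_unfold)

lemma finite_hist_law: "finite (set_pmf (hist_law g t))"
  by (induction t) (auto simp: case_prod_unfold)

lemma finite_obs_law: "finite (set_pmf (obs_law g t))"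
  by (auto simp: obs_law_def case_prod_unfold finite_hist_law)

section \<open>Joint law of the hidden pair and the history\<close>

definition pre_obs :: "('y, 'u) control_law \<Rightarrow> nat \<Rightarrow> ('x, 'w, 'n) outcome \<Rightarrow>
    ('x \<times> 'm) \<times> 'y list \<times> 'u list" where
  "pre_obs g t \<omega> = ((state S c l g (Suc t) \<omega>, memory S c l g t \<omega>), obs_hist S c l g t \<omega>, act_hist S c l g t \<omega>)"

definition post_obs :: "('y, 'u) control_law \<Rightarrow> nat \<Rightarrow> ('x, 'w, 'n) outcome \<Rightarrow>
    ('x \<times> 'm) \<times> 'y list \<times> 'u list" where
  "post_obs g t \<omega> = ((state S c l g (Suc t) \<omega>, memory S c l g (Suc t) \<omega>),
     obs_hist S c l g (Suc t) \<omega>, act_hist S c l g t \<omega>)"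

lemma post_obs_step:
  "post_obs g t \<omega> = (case pre_obs g t \<omega> of ((x, m), ys, us) \<Rightarrow>
     ((x, l (Suc t) x m), ys @ [channel S (c (Suc t) x m) (snd (snd \<omega>) (Suc t))], us))"
  using closed_loop_step[of "Suc t" S c l g \<omega>] by (simp add: post_obs_def pre_obs_def)

lemma pre_obs_step:
  "pre_obs g (Suc t) \<omega> = (case post_obs g t \<omega> of ((x, m), ys, us) \<Rightarrow>
     ((plant S x (g (Suc t) ys us) (fst (snd \<omega>) (Suc t)), m), ys, us @ [g (Suc t) ys us]))"
  using closed_loop_step[of "Suc t" S c l g \<omega>] by (simp add: post_obs_def pre_obs_def control_def)

lemma pre_obs_noise_indep:
  assumes "t < horizon S"
  shows "map_pmf (\<lambda>\<omega>. (pre_obs g t \<omega>, fst (snd \<omega>) (Suc t), snd (snd \<omega>) (Suc t))) (primitives S) =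
    pair_pmf (map_pmf (pre_obs g t) (primitives S)) (pair_pmf (disturbance_pmf S) (noise_pmf S))"
proof -
  define F :: "'x \<times> 'm \<times> 'y list \<times> 'u list \<Rightarrow> _" where "F = (\<lambda>(x, m, ys, us). ((x, m), ys, us))"
  have F: "pre_obs g t = (\<lambda>\<omega>. F (traj S c l g \<omega> t))"
    by (simp add: fun_eq_iff F_def pre_obs_def state_def memory_def obs_hist_def act_hist_def case_prod_unfold)
  from arg_cong[OF traj_noise_indep[OF assms], of "map_pmf (apfst F)" c l g]
  show ?thesis
    by (simp add: map_pmf_comp F flip: pair_map_pmf1)
qed

lemma law_post_obs:
  assumes "t < horizon S"
  shows "map_pmf (post_obs g t) (primitives S) =
    bind_pmf (map_pmf (pre_obs g t) (primitives S)) (\<lambda>((x, m), ys, us).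
      map_pmf (\<lambda>n. ((x, l (Suc t) x m), ys @ [channel S (c (Suc t) x m) n], us)) (noise_pmf S))"
proof -
  let ?F = "\<lambda>(((x, m), ys, us), w::'w, n). ((x, l (Suc t) x m), ys @ [channel S (c (Suc t) x m) n], us)"
  have "map_pmf (post_obs g t) (primitives S) = map_pmf ?F
      (pair_pmf (map_pmf (pre_obs g t) (primitives S)) (pair_pmf (disturbance_pmf S) (noise_pmf S)))"
    unfolding pre_obs_noise_indep[OF assms, symmetric] map_pmf_comp
    by (intro map_pmf_cong) (auto simp: post_obs_step split: prod.splits)
  then show ?thesis
    by (simp add: pair_pmf_def map_pmf_def bind_assoc_pmf bind_return_pmf case_prod_unfold)
qed

lemma law_pre_obs_Suc:
  assumes "t < horizon S"
  shows "map_pmf (pre_obs g (Suc t)) (primitives S) =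
    bind_pmf (map_pmf (post_obs g t) (primitives S)) (\<lambda>((x, m), ys, us).
      map_pmf (\<lambda>w. ((plant S x (g (Suc t) ys us) w, m), ys, us @ [g (Suc t) ys us])) (disturbance_pmf S))"
proof -
  \<comment> \<open>Both half steps are composed at once, since independence is available for the
    two noises jointly with \<open>pre_obs\<close>, not for the disturbance with
    \<open>post_obs\<close>.\<close>
  let ?F = "\<lambda>(((x, m), ys, us), w::'w, n). let ys' = ys @ [channel S (c (Suc t) x m) n]; u = g (Suc t) ys' us
      in ((plant S x u w, l (Suc t) x m), ys', us @ [u])"
  have "map_pmf (pre_obs g (Suc t)) (primitives S) = map_pmf ?F
      (pair_pmf (map_pmf (pre_obs g t) (primitives S)) (pair_pmf (disturbance_pmf S) (noise_pmf S)))"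
    unfolding pre_obs_noise_indep[OF assms, symmetric] map_pmf_comp
    by (intro map_pmf_cong) (auto simp: pre_obs_step post_obs_step Let_def split: prod.splits)
  then show ?thesis
    unfolding law_post_obs[OF assms]
    by (simp add: pair_pmf_def map_pmf_def bind_assoc_pmf bind_return_pmf case_prod_unfold Let_def
        bind_commute_pmf[of "disturbance_pmf S"])
qed

text \<open>Bayes' rule: for a fixed history, \<open>attach_fibre\<close> splits the joint law of
  hidden pair and new observation into the law of the observation and its fibre, which is
  \<open>posterior\<close>.\<close>

lemma attach_posterior:
  "bind_pmf (attach (hist_law g t) (\<lambda>(ys, us). prior t ys us)) (\<lambda>((x, m), ys, us).
      map_pmf (\<lambda>n. ((x, l (Suc t) x m), ys @ [channel S (c (Suc t) x m) n], us)) (noise_pmf S)) =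
    attach (obs_law g t) (\<lambda>(ys, us). posterior t ys us)" (is "?L = ?R")
proof -
  let ?O = "\<lambda>h. observe (Suc t) (prior t (fst h) (snd h))"
  have "?L = bind_pmf (hist_law g t) (\<lambda>h. map_pmf (\<lambda>(s, y). (s, fst h @ [y], snd h)) (?O h))"
    by (simp add: attach_def observe_def map_pmf_def bind_assoc_pmf bind_return_pmf case_prod_unfold)
  also have "\<dots> = bind_pmf (hist_law g t) (\<lambda>h. map_pmf (\<lambda>(s, y). (s, fst h @ [y], snd h))
      (attach (map_pmf snd (?O h)) (fibre (?O h))))"
    unfolding attach_fibre ..
  also have "\<dots> = ?R"
    by (simp add: attach_def obs_law_def posterior_def map_pmf_def bind_assoc_pmf bind_return_pmf case_prod_unfold)
  finally show ?thesis .
qed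

text \<open>The new action is a function of the history already conditioned on, so it reveals
  nothing more about the hidden pair and enters \<open>predict\<close> only through its
  value.\<close>

lemma attach_prior_Suc:
  "bind_pmf (attach (obs_law g t) (\<lambda>(ys, us). posterior t ys us)) (\<lambda>((x, m), ys, us).
      map_pmf (\<lambda>w. ((plant S x (g (Suc t) ys us) w, m), ys, us @ [g (Suc t) ys us])) (disturbance_pmf S)) =
    attach (hist_law g (Suc t)) (\<lambda>(ys, us). prior (Suc t) ys us)"
  by (simp add: attach_def hist_law_Suc prior_Suc_append predict_def map_pmf_def bind_assoc_pmf
      bind_return_pmf case_prod_unfold del: hist_law.simps prior.simps)

lemma law_pre_obs:
  assumes "t \<le> horizon S"
  shows "map_pmf (pre_obs g t) (primitives S) = attach (hist_law g t) (\<lambda>(ys, us). prior t ys us)"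
  using assms
proof (induction t)
  case 0
  have "pre_obs g 0 = (\<lambda>\<omega>. ((fst \<omega>, init_mem S), [], []))"
    using closed_loop_init[of S c l g] by (simp add: pre_obs_def fun_eq_iff)
  then show ?case
    by (simp add: attach_def bind_return_pmf primitives_def pair_pmf_def map_pmf_def bind_assoc_pmf)
next
  case (Suc t)
  then show ?case
    by (simp add: law_pre_obs_Suc law_post_obs attach_posterior attach_prior_Suc
        del: hist_law.simps prior.simps)
qed

lemma law_post_obs_attach:
  assumes "t < horizon S"
  shows "map_pmf (post_obs g t) (primitives S) = attach (obs_law g t) (\<lambda>(ys, us). posterior t ys us)"
  using assms by (simp add: law_post_obs law_pre_obs attach_posterior)

text \<open>The belief is the fibre of the law of \<open>post_obs\<close> at the realized history,
  which has positive probability, so uniqueness of the disintegration applies.\<close>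

lemma belief_eq_posterior:
  assumes "t < horizon S" "\<omega> \<in> set_pmf (primitives S)"
  shows "belief S c l g (Suc t) \<omega> = posterior t (obs_hist S c l g (Suc t) \<omega>) (act_hist S c l g t \<omega>)"
proof -
  let ?h = "(obs_hist S c l g (Suc t) \<omega>, act_hist S c l g t \<omega>)"
  let ?P = "map_pmf (post_obs g t) (primitives S)"
  have "belief S c l g (Suc t) \<omega> =
      map_pmf fst (map_pmf (post_obs g t) (cond_pmf (primitives S) (post_obs g t -` (snd -` {?h}))))"
    unfolding belief_def map_pmf_comp by (simp add: post_obs_def vimage_def)
  also have "\<dots> = fibre ?P ?h"
    unfolding fibre_def
    by (subst cond_map_pmf) (use assms(2) in \<open>auto simp: post_obs_def\<close>)
  also have "\<dots> = posterior t (fst ?h) (snd ?h)"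
  proof -
    have "?h \<in> set_pmf (map_pmf snd ?P)"
      using assms(2) by (force simp: post_obs_def)
    then have "?h \<in> set_pmf (obs_law g t)"
      unfolding law_post_obs_attach[OF assms(1)] map_snd_attach .
    then show ?thesis
      unfolding law_post_obs_attach[OF assms(1)] by (simp add: fibre_attach)
  qed
  finally show ?thesis by simp
qed

section \<open>Dynamic programming on beliefs\<close>

definition mean_cost :: "('x \<times> 'm) pmf \<Rightarrow> 'u \<Rightarrow> real" where
  "mean_cost b u = measure_pmf.expectation b (\<lambda>(x, m). cost S x u)"

text \<open>
  The first argument is the number of actions that are still to be chosen; \<open>p\<close> is a prior at
  time \<open>t\<close>, so the expectation over the next observation comes before the minimum.
\<close>
primrec cost_to_go :: "nat \<Rightarrow> nat \<Rightarrow> ('x \<times> 'm) pmf \<Rightarrow> real" where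
  "cost_to_go 0 t p = 0"
| "cost_to_go (Suc k) t p = measure_pmf.expectation (map_pmf snd (observe (Suc t) p))
     (\<lambda>y. let b = fibre (observe (Suc t) p) y
      in Min (range (\<lambda>u. mean_cost b u + cost_to_go k (Suc t) (predict b u))))"

text \<open>\<open>k\<close> counts the actions after \<open>u\<close>; \<open>b\<close> is a belief
  after observation \<open>t\<close>, and \<open>predict b u\<close> is a prior with the same index
  \<open>t\<close>.\<close>

definition action_value :: "nat \<Rightarrow> nat \<Rightarrow> ('x \<times> 'm) pmf \<Rightarrow> 'u \<Rightarrow> real" where
  "action_value k t b u = mean_cost b u + cost_to_go k t (predict b u)"

definition remaining_cost :: "('y, 'u) control_law \<Rightarrow> nat \<Rightarrow> real" where
  "remaining_cost g t = (\<Sum>s\<in>{t<..horizon S}.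
     measure_pmf.expectation (primitives S) (\<lambda>\<omega>. cost S (state S c l g s \<omega>) (control S c l g s \<omega>)))"

lemma finite_primitives: "finite (set_pmf (primitives S))"
  by (auto simp: primitives_def set_Pi_pmf intro!: finite_cartesian_product)

lemma performance_eq_remaining_cost: "performance S c l g = remaining_cost g 0"
proof -
  have "{1..horizon S} = {0<..horizon S}" by auto
  then show ?thesis
    by (simp add: performance_def remaining_cost_def Bochner_Integration.integral_sum
      integrable_measure_pmf_finite finite_primitives)
qed

text \<open>Tower property: given the history the action is fixed, so only the posterior
  matters.\<close>

lemma expected_cost:
  assumes "t < horizon S"
  shows "measure_pmf.expectation (primitives S)
      (\<lambda>\<omega>. cost S (state S c l g (Suc t) \<omega>) (control S c l g (Suc t) \<omega>)) =
    measure_pmf.expectation (obs_law g t) (\<lambda>(ys, us). mean_cost (posterior t ys us) (g (Suc t) ys us))"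
proof -
  have "measure_pmf.expectation (primitives S)
      (\<lambda>\<omega>. cost S (state S c l g (Suc t) \<omega>) (control S c l g (Suc t) \<omega>)) =
    measure_pmf.expectation (map_pmf (post_obs g t) (primitives S))
      (\<lambda>((x, m), ys, us). cost S x (g (Suc t) ys us))"
    by (simp add: post_obs_def control_def)
  also have "\<dots> = measure_pmf.expectation (obs_law g t)
      (\<lambda>(ys, us). mean_cost (posterior t ys us) (g (Suc t) ys us))"
    unfolding law_post_obs_attach[OF assms] attach_def
    by (subst expectation_bind_pmf) (auto simp: finite_obs_law mean_cost_def case_prod_unfold)
  finally show ?thesis .
qed

lemma remaining_cost_Suc:
  assumes "t < horizon S"
  shows "remaining_cost g t =
    measure_pmf.expectation (obs_law g t) (\<lambda>(ys, us). mean_cost (posterior t ys us) (g (Suc t) ys us)) +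
    remaining_cost g (Suc t)"
proof -
  have "{t<..horizon S} = insert (Suc t) {Suc t<..horizon S}" using assms by auto
  then show ?thesis by (simp add: remaining_cost_def expected_cost[OF assms])
qed

lemma expectation_cost_to_go_Suc:
  "measure_pmf.expectation (hist_law g t) (\<lambda>(ys, us). cost_to_go (Suc k) t (prior t ys us)) =
   measure_pmf.expectation (obs_law g t)
     (\<lambda>(ys, us). Min (range (action_value k (Suc t) (posterior t ys us))))"
  unfolding obs_law_def
  by (subst expectation_bind_pmf)
    (auto simp: finite_hist_law posterior_def action_value_def[abs_def] Let_def case_prod_unfold)

lemma expectation_action_value:
  "measure_pmf.expectation (obs_law g t)
     (\<lambda>(ys, us). action_value k (Suc t) (posterior t ys us) (g (Suc t) ys us)) =
   measure_pmf.expectation (obs_law g t) (\<lambda>(ys, us). mean_cost (posterior t ys us) (g (Suc t) ys us)) +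
   measure_pmf.expectation (hist_law g (Suc t)) (\<lambda>(ys, us). cost_to_go k (Suc t) (prior (Suc t) ys us))"
  unfolding hist_law_Suc
  by (simp add: case_prod_unfold prior_Suc_append action_value_def integrable_measure_pmf_finite
      finite_obs_law del: prior.simps)

text \<open>Backward induction: at each belief the minimum is at most the value of the action that
  \<open>g\<close> takes, and the induction hypothesis bounds the rest.\<close>

lemma cost_to_go_le_remaining_cost:
  assumes "t + k = horizon S"
  shows "measure_pmf.expectation (hist_law g t) (\<lambda>(ys, us). cost_to_go k t (prior t ys us)) \<le> remaining_cost g t"
  using assms
proof (induction k arbitrary: t)
  case 0
  then show ?case by (simp add: remaining_cost_def)
next
  case (Suc k)
  have "measure_pmf.expectation (hist_law g t) (\<lambda>(ys, us). cost_to_go (Suc k) t (prior t ys us)) \<le>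
    measure_pmf.expectation (obs_law g t)
     (\<lambda>(ys, us). action_value k (Suc t) (posterior t ys us) (g (Suc t) ys us))"
    unfolding expectation_cost_to_go_Suc
    by (intro expectation_mono_pmf finite_obs_law) auto
  also have "\<dots> \<le> remaining_cost g t"
    using Suc.IH[of "Suc t"] Suc.prems by (simp add: expectation_action_value remaining_cost_Suc del: hist_law.simps prior.simps)
  finally show ?case .
qed

section \<open>An optimal law that sees only the belief\<close>

definition greedy :: "('x, 'm, 'u) belief_law" where
  "greedy t b = arg_min_on (action_value (horizon S - t) t b) UNIV"

text \<open>Built on \<open>posterior\<close>, which is free of the control law;
  \<open>belief\<close> depends on the law in use, so using it here would be circular. The belief at
  time t is \<open>posterior (t - 1)\<close>.\<close>

definition greedy_law :: "('y, 'u) control_law" where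
  "greedy_law t ys us = greedy t (posterior (t - 1) ys us)"

lemma action_value_greedy:
  "action_value (horizon S - t) t b (greedy t b) = Min (range (action_value (horizon S - t) t b))"
proof -
  let ?f = "action_value (horizon S - t) t b"
  have "?f (greedy t b) \<le> ?f u" for u
    unfolding greedy_def by (rule arg_min_least) auto
  then show ?thesis by (intro Min_eqI[symmetric]) auto
qed

text \<open>The greedy action attains each minimum, so the bound of
  \<open>cost_to_go_le_remaining_cost\<close> becomes an equality.\<close>

lemma remaining_cost_greedy_law:
  assumes "t + k = horizon S"
  shows "remaining_cost greedy_law t =
    measure_pmf.expectation (hist_law greedy_law t) (\<lambda>(ys, us). cost_to_go k t (prior t ys us))"
  using assms
proof (induction k arbitrary: t)
  case 0
  then show ?case by (simp add: remaining_cost_def)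
next
  case (Suc k)
  then have k: "k = horizon S - Suc t" by simp
  have "measure_pmf.expectation (hist_law greedy_law t) (\<lambda>(ys, us). cost_to_go (Suc k) t (prior t ys us)) =
    measure_pmf.expectation (obs_law greedy_law t)
     (\<lambda>(ys, us). action_value k (Suc t) (posterior t ys us) (greedy_law (Suc t) ys us))"
    unfolding expectation_cost_to_go_Suc by (simp add: greedy_law_def k action_value_greedy)
  also have "\<dots> = remaining_cost greedy_law t"
    using Suc.IH[of "Suc t"] Suc.prems by (simp add: expectation_action_value remaining_cost_Suc del: hist_law.simps prior.simps)
  finally show ?case ..
qed

text \<open>At time 0 the history is empty under every law, so both sides are compared with the same
  value of \<open>cost_to_go\<close>.\<close>

lemma performance_greedy_law_le: "performance S c l greedy_law \<le> performance S c l g"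
  using cost_to_go_le_remaining_cost[of 0 "horizon S" g] remaining_cost_greedy_law[of 0 "horizon S"]
  by (simp add: performance_eq_remaining_cost)

lemma belief_form_greedy_law: "belief_form S c l greedy_law greedy"
  unfolding belief_form_def
proof (intro ballI)
  fix t assume "t \<in> {1..horizon S}"
  then obtain s where s: "t = Suc s" "s < horizon S" by (cases t) auto
  show "AE \<omega> in measure_pmf (primitives S).
      control S c l greedy_law t \<omega> = greedy t (belief S c l greedy_law t \<omega>)"
    using s by (auto simp: AE_measure_pmf_iff belief_eq_posterior control_def greedy_law_def)
qed

end

theorem theorem1:
  fixes S :: "('x::finite, 'w::finite, 'm::finite, 'z::finite, 'n::finite, 'y::finite, 'u::finite) ncs"
    and c :: "('x, 'm, 'z) encoder"
    and l :: "('x, 'm) memory_update"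
    and K :: real
  assumes cost_bounds: "\<And>x u. 0 \<le> cost S x u \<and> cost S x u \<le> K"
  shows "\<exists>(\<gamma> :: ('x, 'm, 'u) belief_law) (g :: ('y, 'u) control_law).
           belief_form S c l g \<gamma> \<and>
           (\<forall>g' :: ('y, 'u) control_law. performance S c l g \<le> performance S c l g')"
  using belief_form_greedy_law performance_greedy_law_le by blast

end
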